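(* Let $n\ge 1$, $N=2^n$, and let $a,M$ be integers with $M\ge 1$ and $0\le a<a+M\le N$. There is a quantum circuit $U_S$, acting on an $n$-qubit register, a flag qubit, and $O(n)$ further ancilla qubits that are initialized to $|0\rangle$ and returned to $|0\rangle$, of depth $O(n)$, such that (ignoring these further ancillas) for every $0\le i\le N-1$ $$U_S|i\rangle|0\rangle_{\mathrm{flag}}=\begin{cases}|i\rangle|1\rangle_{\mathrm{flag}}, & a\le i<a+M,\\ |i\rangle|0\rangle_{\mathrm{flag}}, & \text{otherwise.}\end{cases}$$ Furthermore, for every normalized $n$-qubit state $|\psi_{\mathrm{test}}\rangle$, setting $|\psi_{\mathrm{sequency}}\rangle=H_S|\psi_{\mathrm{test}}\rangle$ with $H_S$ the sequency-ordered Walsh-Hadamard transform, the probability of obtaining outcome $1$ when measuring the flag qubit of $U_S|\psi_{\mathrm{sequency}}\rangle|0\rangle_{\mathrm{flag}}$ in the computational basis equals $$P_{[a,a+M)}=\sum_{j=a}^{a+M-1}\left|\langle j|\psi_{\mathrm{sequency}}\rangle\right|^2 .$$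
   Context: The sequency-ordered Walsh-Hadamard transform $H_S$ is the linear map on the complex vector space with orthonormal basis $|0\rangle,\dots,|N-1\rangle$ given by $$H_S|j\rangle=\frac1{\sqrt N}\sum_{k=0}^{N-1}(-1)^{\sum_{r=0}^{n-1}k_{n-1-r}(j_r\oplus j_{r+1})}|k\rangle,$$ where $k=\sum_i k_i2^i$, $j=\sum_i j_i2^i$ are binary expansions with bits $k_i,j_i\in\{0,1\}$, $j_n:=0$, and $\oplus$ is addition modulo $2$. Circuits are built from elementary gates each acting on at most three qubits (such as $X$, CNOT and Toffoli); depth is the number of layers of gates, the gates within one layer acting on disjoint qubits. *)

theory Defs
  imports
    "Jordan_Normal_Form.Schur_Decomposition"
    "HOL-Library.Landau_Symbols"
begin

text \<open>
  The state space of \<open>w\<close> qubits is the space of complex vectors of dimension \<open>2 ^ w\<close>, with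
  computational basis \<open>|i\<rangle> = unit_vec (2 ^ w) i\<close>. Qubit \<open>q\<close> carries the bit \<open>bit i q\<close> of weight
  \<open>2 ^ q\<close> of the basis label \<open>i\<close>. Accordingly the left factor of a tensor product
  occupies the low-order qubits.
\<close>

abbreviation ket :: "nat \<Rightarrow> nat \<Rightarrow> complex vec" where
  "ket w i \<equiv> unit_vec (2 ^ w) i"

definition tensor_vec :: "complex vec \<Rightarrow> complex vec \<Rightarrow> complex vec" (infixl "\<otimes>\<^sub>v" 72) where
  "u \<otimes>\<^sub>v v = vec (dim_vec u * dim_vec v) (\<lambda>i. u $ (i mod dim_vec u) * v $ (i div dim_vec u))"

text \<open>The scalar product \<open>\<bullet>c\<close> is antilinear in its second argument.\<close>

definition braket :: "complex vec \<Rightarrow> complex vec \<Rightarrow> complex" where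
  "braket u v = v \<bullet>c u"

definition normalized :: "complex vec \<Rightarrow> bool" where
  "normalized v \<longleftrightarrow> braket v v = 1"

definition unitary :: "complex mat \<Rightarrow> bool" where
  "unitary U \<longleftrightarrow> square_mat U \<and> inverts_mat U (mat_adjoint U) \<and> inverts_mat (mat_adjoint U) U"


text \<open>
  A gate consists of the list of qubits it acts on and its matrix; the \<open>r\<close>-th entry of the list
  is the qubit of weight \<open>2 ^ r\<close> in the row and column indices of the matrix.
\<close>

datatype gate = Gate (qubits: "nat list") (gate_mat: "complex mat")

definition valid_gate :: "nat \<Rightarrow> gate \<Rightarrow> bool" where
  "valid_gate w g \<longleftrightarrow>
     distinct (qubits g) \<and> set (qubits g) \<subseteq> {..<w} \<and> length (qubits g) \<le> 3 \<and>
     gate_mat g \<in> carrier_mat (2 ^ length (qubits g)) (2 ^ length (qubits g)) \<and>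
     unitary (gate_mat g)"

definition sub_index :: "nat list \<Rightarrow> nat \<Rightarrow> nat" where
  "sub_index qs x = horner_sum of_bool 2 (map (bit x) qs)"

definition gate_op :: "nat \<Rightarrow> gate \<Rightarrow> complex mat" where
  "gate_op w g = mat (2 ^ w) (2 ^ w) (\<lambda>(x, y).
     if \<forall>q<w. q \<notin> set (qubits g) \<longrightarrow> bit x q = bit y q
     then gate_mat g $$ (sub_index (qubits g) x, sub_index (qubits g) y) else 0)"

type_synonym layer = "gate list"
type_synonym circuit = "layer list"

definition valid_layer :: "nat \<Rightarrow> layer \<Rightarrow> bool" where
  "valid_layer w L \<longleftrightarrow> (\<forall>g\<in>set L. valid_gate w g) \<and> distinct (concat (map qubits L))"

definition valid_circuit :: "nat \<Rightarrow> circuit \<Rightarrow> bool" where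
  "valid_circuit w c \<longleftrightarrow> (\<forall>L\<in>set c. valid_layer w L)"

definition depth :: "circuit \<Rightarrow> nat" where
  "depth c = length c"

text \<open>
  The gates of a valid layer commute. The head of a circuit is the layer applied first.
\<close>

definition layer_op :: "nat \<Rightarrow> layer \<Rightarrow> complex mat" where
  "layer_op w L = foldl (\<lambda>U g. gate_op w g * U) (1\<^sub>m (2 ^ w)) L"

definition circuit_op :: "nat \<Rightarrow> circuit \<Rightarrow> complex mat" where
  "circuit_op w c = foldl (\<lambda>U L. layer_op w L * U) (1\<^sub>m (2 ^ w)) c"


text \<open>Born rule for measuring qubit \<open>q\<close> of a state of \<open>w\<close> qubits in the computational basis.\<close>

definition prob_one :: "nat \<Rightarrow> nat \<Rightarrow> complex vec \<Rightarrow> real" where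
  "prob_one w q \<phi> = (\<Sum>x | x < 2 ^ w \<and> bit x q. (cmod (braket (ket w x) \<phi>))\<^sup>2)"


definition bin_digit :: "nat \<Rightarrow> nat \<Rightarrow> nat" where
  "bin_digit j r = of_bool (bit j r)"

text \<open>
  Entry \<open>(k, j)\<close> is the coefficient of \<open>|k\<rangle>\<close> in the image of \<open>|j\<rangle>\<close>. The convention that
  \<open>j\<close> has digit \<open>0\<close> at position \<open>n\<close> holds automatically since \<open>j < 2 ^ n\<close>.
\<close>

definition seq_walsh_hadamard :: "nat \<Rightarrow> complex mat" where
  "seq_walsh_hadamard n = mat (2 ^ n) (2 ^ n) (\<lambda>(k, j).
     complex_of_real (1 / sqrt (2 ^ n)) *
     (-1) ^ (\<Sum>r<n. bin_digit k (n - 1 - r) * ((bin_digit j r + bin_digit j (r + 1)) mod 2)))"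

end

theory Submission
  imports Defs
begin

text \<open>
  Gates that flip one qubit depending on two others permute the basis states and are involutions.
  Comparing \<open>i\<close> with a constant \<open>t\<close> from the lowest bit upwards takes one such gate and one ancilla
  per bit. Comparing with both ends of the interval, setting the flag, and undoing the comparisons
  gives a palindromic circuit, so the basis permutation \<open>\<sigma>\<close> that it induces is an involution. Hence
  the output amplitude at \<open>x\<close> is the input amplitude at \<open>\<sigma> x\<close>, and reindexing the sum of Born
  probabilities by \<open>\<sigma>\<close> leaves exactly the labels in the interval.
\<close>

section \<open>Matrices that permute the computational basis\<close>

definition perm_mat :: "nat \<Rightarrow> (nat \<Rightarrow> nat) \<Rightarrow> complex mat" where
  "perm_mat d \<sigma> = mat d d (\<lambda>(x, y). if x = \<sigma> y then 1 else 0)"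

lemma perm_mat_carrier [simp]: "perm_mat d \<sigma> \<in> carrier_mat d d"
  by (simp add: perm_mat_def)

lemma perm_mat_id: "perm_mat d (\<lambda>x. x) = 1\<^sub>m d"
  by (rule eq_matI) (auto simp: perm_mat_def)

lemma perm_mat_mult:
  assumes "\<And>x. x < d \<Longrightarrow> \<tau> x < d"
  shows "perm_mat d \<sigma> * perm_mat d \<tau> = perm_mat d (\<lambda>x. \<sigma> (\<tau> x))"
proof (rule eq_matI)
  fix i j
  assume "i < dim_row (perm_mat d (\<lambda>x. \<sigma> (\<tau> x)))" "j < dim_col (perm_mat d (\<lambda>x. \<sigma> (\<tau> x)))"
  then have ij: "i < d" "j < d" by (auto simp: perm_mat_def)
  have "(perm_mat d \<sigma> * perm_mat d \<tau>) $$ (i, j) =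
      (\<Sum>k = 0..<d. (if i = \<sigma> k then 1 else 0) * (if k = \<tau> j then 1 else 0))"
    using ij by (simp add: perm_mat_def scalar_prod_def)
  also have "\<dots> = (\<Sum>k = 0..<d. if k = \<tau> j then (if i = \<sigma> k then 1 else 0) else 0)"
    by (intro sum.cong) auto
  also have "\<dots> = (if i = \<sigma> (\<tau> j) then 1 else 0)"
    using assms[OF ij(2)] by (subst sum.delta) auto
  finally show "(perm_mat d \<sigma> * perm_mat d \<tau>) $$ (i, j) = perm_mat d (\<lambda>x. \<sigma> (\<tau> x)) $$ (i, j)"
    using ij by (simp add: perm_mat_def)
qed (simp_all add: perm_mat_def)

text \<open>Since \<open>\<sigma>\<close> is its own inverse, the only nonzero entry of row
  \<open>i\<close> sits in column \<open>\<sigma> i\<close>; hence \<open>\<sigma>\<close> itself,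
  rather than its inverse, reindexes the amplitudes.\<close>

lemma perm_mat_mult_vec:
  assumes "\<And>x. x < d \<Longrightarrow> \<sigma> x < d" "\<And>x. \<sigma> (\<sigma> x) = x" "v \<in> carrier_vec d"
  shows "perm_mat d \<sigma> *\<^sub>v v = vec d (\<lambda>x. v $ \<sigma> x)"
proof (rule eq_vecI)
  fix i assume "i < dim_vec (vec d (\<lambda>x. v $ \<sigma> x))"
  then have i: "i < d" by simp
  have "(perm_mat d \<sigma> *\<^sub>v v) $ i = (\<Sum>k = 0..<d. (if i = \<sigma> k then 1 else 0) * v $ k)"
    using i assms(3) by (simp add: perm_mat_def scalar_prod_def)
  also have "\<dots> = (\<Sum>k = 0..<d. if k = \<sigma> i then v $ k else 0)"
    using assms(2) by (intro sum.cong) auto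
  also have "\<dots> = v $ \<sigma> i"
    using assms(1)[OF i] by (subst sum.delta) auto
  finally show "(perm_mat d \<sigma> *\<^sub>v v) $ i = vec d (\<lambda>x. v $ \<sigma> x) $ i"
    using i by simp
qed (simp add: perm_mat_def)

lemma perm_mat_mult_unit_vec:
  assumes "\<And>x. x < d \<Longrightarrow> \<sigma> x < d" "\<And>x. \<sigma> (\<sigma> x) = x" "y < d"
  shows "perm_mat d \<sigma> *\<^sub>v unit_vec d y = unit_vec d (\<sigma> y)"
proof -
  have "(x = \<sigma> y) = (\<sigma> x = y)" for x
    using assms(2) by auto
  with assms show ?thesis
    by (subst perm_mat_mult_vec) (auto simp: unit_vec_def intro!: eq_vecI)
qed

text \<open>The matrix of an involution is real and symmetric, so it is its own adjoint as well as
  its own inverse.\<close>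

lemma unitary_perm_mat:
  assumes "\<And>x. x < d \<Longrightarrow> \<sigma> x < d" "\<And>x. \<sigma> (\<sigma> x) = x"
  shows "unitary (perm_mat d \<sigma>)"
proof -
  have "mat_adjoint (perm_mat d \<sigma>) = perm_mat d \<sigma>"
    using assms(2) by (intro eq_matI) (auto simp: mat_adjoint_def perm_mat_def mat_of_rows_def)
  moreover have "perm_mat d \<sigma> * perm_mat d \<sigma> = 1\<^sub>m d"
    using assms by (simp add: perm_mat_mult perm_mat_id)
  ultimately show ?thesis
    by (simp add: unitary_def inverts_mat_def) (simp add: perm_mat_def)
qed


section \<open>Three-qubit gates that flip a target conditionally\<close>

type_synonym xor_spec = "(bool \<Rightarrow> bool \<Rightarrow> bool) \<times> nat \<times> nat \<times> nat"

text \<open>Controls \<open>p\<close> and \<open>q\<close>, target \<open>r\<close>. Allowing any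
  Boolean \<open>F\<close> lets the bits of a classical constant be built into the gate instead of
  being stored in qubits.\<close>

fun xor_step :: "xor_spec \<Rightarrow> nat \<Rightarrow> nat" where
  "xor_step (F, p, q, r) x = (if F (bit x p) (bit x q) then flip_bit r x else x)"

fun xor_gate :: "xor_spec \<Rightarrow> gate" where
  "xor_gate (F, p, q, r) = Gate [p, q, r] (perm_mat 8 (xor_step (F, 0, 1, 2)))"

fun valid_spec :: "nat \<Rightarrow> xor_spec \<Rightarrow> bool" where
  "valid_spec w (F, p, q, r) \<longleftrightarrow> distinct [p, q, r] \<and> {p, q, r} \<subseteq> {..<w}"

text \<open>Such a gate neither reads nor writes bit \<open>k\<close>, so it commutes with flipping
  that bit.\<close>

fun avoids :: "nat \<Rightarrow> xor_spec \<Rightarrow> bool" where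
  "avoids k (F, p, q, r) \<longleftrightarrow> k \<noteq> p \<and> k \<noteq> q \<and> k \<noteq> r"

lemma bit_xor_step:
  "bit (xor_step (F, p, q, r) x) j \<longleftrightarrow>
    (if j = r \<and> F (bit x p) (bit x q) then \<not> bit x j else bit x j)"
  by (simp add: bit_flip_bit_iff)

text \<open>Turns range conditions on labels into conditions on single bits, the form in which the
  action of a gate is known.\<close>

lemma less_exp_iff_bit: "x < 2 ^ w \<longleftrightarrow> (\<forall>j\<ge>w. \<not> bit x j)" for x :: nat
proof
  assume "x < 2 ^ w"
  then have "take_bit w x = x" by (simp add: take_bit_nat_eq_self)
  then show "\<forall>j\<ge>w. \<not> bit x j"
    by (metis bit_take_bit_iff leD)
next
  assume "\<forall>j\<ge>w. \<not> bit x j"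
  then have "take_bit w x = x"
    by (intro bit_eqI) (metis bit_take_bit_iff not_less)
  then show "x < 2 ^ w"
    by (metis take_bit_nat_less_exp)
qed

lemma xor_step_less: "valid_spec w g \<Longrightarrow> x < 2 ^ w \<Longrightarrow> xor_step g x < 2 ^ w"
  by (cases g) (auto simp: less_exp_iff_bit bit_flip_bit_iff)

text \<open>The target differs from both controls, so the second application sees the same value of
  \<open>F\<close> and undoes the flip.\<close>

lemma xor_step_involutive: "valid_spec w g \<Longrightarrow> xor_step g (xor_step g x) = x"
  by (cases g) (auto intro!: bit_eqI simp: bit_flip_bit_iff)

lemma xor_step_flip_bit:
  "avoids k g \<Longrightarrow> xor_step g (flip_bit k x) = flip_bit k (xor_step g x)"
  by (cases g) (auto intro!: bit_eqI simp: bit_flip_bit_iff)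

declare xor_step.simps [simp del]

lemma valid_xor_gate:
  assumes "valid_spec w g"
  shows "valid_gate w (xor_gate g)"
proof (cases g)
  case (fields F p q r)
  \<comment> \<open>The local matrix is the same kind of step on a register of three qubits, with 8
    = 2 ^ 3, so the general facts about steps apply to it.\<close>
  have v: "valid_spec 3 (F, 0, 1, 2)" by simp
  have "unitary (perm_mat 8 (xor_step (F, 0, 1, 2)))"
    using xor_step_less[OF v] xor_step_involutive[OF v] by (intro unitary_perm_mat) auto
  with assms fields show ?thesis
    by (auto simp: valid_gate_def)
qed

lemma bit_sub_index: "bit (sub_index qs x) k \<longleftrightarrow> k < length qs \<and> bit x (qs ! k)"
  by (auto simp: sub_index_def bit_horner_sum_bit_iff)

text \<open>An entry of \<open>gate_op\<close> is 1 exactly if the labels agree off the three qubits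
  and their local indices are related by the local step. Compared bit by bit, this says that the row
  label is the global step of the column label.\<close>

lemma gate_op_xor_gate:
  assumes "valid_spec w g"
  shows "gate_op w (xor_gate g) = perm_mat (2 ^ w) (xor_step g)"
proof (cases g)
  case (fields F p q r)
  have d: "p \<noteq> q" "p \<noteq> r" "q \<noteq> r" "p < w" "q < w" "r < w"
    using assms fields by auto
  define qs where "qs = [p, q, r]"
  have len: "sub_index qs x < 8" for x
    using less_exp_iff_bit[of "sub_index qs x" 3] by (auto simp: bit_sub_index qs_def)
  have sub: "bit (sub_index qs x) 0 = bit x p" "bit (sub_index qs x) 1 = bit x q"
    "bit (sub_index qs x) 2 = bit x r" "j \<ge> 3 \<Longrightarrow> \<not> bit (sub_index qs x) j" for x j
    by (simp_all add: bit_sub_index qs_def del: One_nat_def)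
  have key: "(\<forall>j<w. j \<notin> set qs \<longrightarrow> bit x j = bit y j) \<and>
       sub_index qs x = xor_step (F, 0, 1, 2) (sub_index qs y) \<longleftrightarrow> x = xor_step (F, p, q, r) y"
    (is "?L \<longleftrightarrow> ?R") if xy: "x < 2 ^ w" "y < 2 ^ w" for x y
  proof
    assume L: ?L
    then have b: "bit (sub_index qs x) k = bit (xor_step (F, 0, 1, 2) (sub_index qs y)) k" for k
      by simp
    show ?R
    proof (rule bit_eqI)
      fix j
      \<comment> \<open>Bits \<open>p\<close>, \<open>q\<close>, \<open>r\<close> are read off from
        bits 0, 1, 2 of the local index; other bits below \<open>w\<close> agree by assumption, and
        those from \<open>w\<close> on vanish on both sides.\<close>
      consider "j = p" | "j = q" | "j = r" | "j < w" "j \<notin> set qs" | "j \<ge> w"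
        by (force simp: qs_def)
      then show "bit x j \<longleftrightarrow> bit (xor_step (F, p, q, r) y) j"
      proof cases
        case 1 then show ?thesis using b[of 0] d by (simp only: bit_xor_step sub) simp
      next
        case 2 then show ?thesis using b[of 1] d by (simp only: bit_xor_step sub) simp
      next
        case 3 then show ?thesis using b[of 2] d by (simp only: bit_xor_step sub) simp
      next
        case 4 then show ?thesis using L by (simp only: bit_xor_step) (simp add: qs_def)
      next
        case 5 then show ?thesis using xy d by (simp only: bit_xor_step less_exp_iff_bit) simp
      qed
    qed
  next
    assume R: ?R
    have "sub_index qs x = xor_step (F, 0, 1, 2) (sub_index qs y)"
    proof (rule bit_eqI)
      fix j :: nat
      consider "j = 0" | "j = 1" | "j = 2" | "j \<ge> 3" by linarith
      then show "bit (sub_index qs x) j \<longleftrightarrow> bit (xor_step (F, 0, 1, 2) (sub_index qs y)) j"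
        by cases (use d in \<open>simp_all only: R bit_xor_step sub\<close>, auto)
    qed
    moreover have "\<forall>j<w. j \<notin> set qs \<longrightarrow> bit x j = bit y j"
      unfolding R bit_xor_step by (auto simp: qs_def)
    ultimately show ?L by blast
  qed
  show ?thesis
  proof (rule eq_matI)
    fix x y
    assume "x < dim_row (perm_mat (2 ^ w) (xor_step g))" "y < dim_col (perm_mat (2 ^ w) (xor_step g))"
    then have xy: "x < 2 ^ w" "y < 2 ^ w" by (simp_all add: perm_mat_def)
    show "gate_op w (xor_gate g) $$ (x, y) = perm_mat (2 ^ w) (xor_step g) $$ (x, y)"
      using key[OF xy] xy len
      by (auto simp: gate_op_def perm_mat_def fields simp flip: qs_def)
  qed (simp_all add: gate_op_def perm_mat_def)
qed


section \<open>Circuits with one gate per layer\<close>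

abbreviation run :: "xor_spec list \<Rightarrow> nat \<Rightarrow> nat" where
  "run gs \<equiv> fold xor_step gs"

text \<open>Fully sequential: depth is the number of gates, so linearly many gates already give
  linear depth.\<close>

definition xor_circuit :: "xor_spec list \<Rightarrow> circuit" where
  "xor_circuit gs = map (\<lambda>g. [xor_gate g]) gs"

lemma run_less: "\<forall>g\<in>set gs. valid_spec w g \<Longrightarrow> x < 2 ^ w \<Longrightarrow> run gs x < 2 ^ w"
  by (induction gs arbitrary: x) (auto simp: xor_step_less)

lemma run_rev_run: "\<forall>g\<in>set gs. valid_spec w g \<Longrightarrow> run (rev gs) (run gs x) = x"
  by (induction gs arbitrary: x) (auto simp: xor_step_involutive)

text \<open>Used to move the flip of the flag past the gates that undo the comparisons.\<close>

lemma run_flip_bit: "\<forall>g\<in>set gs. avoids k g \<Longrightarrow> run gs (flip_bit k x) = flip_bit k (run gs x)"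
  by (induction gs arbitrary: x) (auto simp: xor_step_flip_bit)

lemma valid_xor_circuit: "\<forall>g\<in>set gs. valid_spec w g \<Longrightarrow> valid_circuit w (xor_circuit gs)"
  by (auto simp: valid_circuit_def valid_layer_def xor_circuit_def valid_xor_gate)

lemma circuit_op_xor_circuit:
  "\<forall>g\<in>set gs. valid_spec w g \<Longrightarrow> circuit_op w (xor_circuit gs) = perm_mat (2 ^ w) (run gs)"
\<comment> \<open>Induction from the end of the list, because the layer applied last is the leftmost
  factor of the product.\<close>
proof (induction gs rule: rev_induct)
  case Nil
  show ?case
    by (simp add: circuit_op_def xor_circuit_def perm_mat_id id_def)
next
  case (snoc g gs)
  have "circuit_op w (xor_circuit (gs @ [g])) =
      layer_op w [xor_gate g] * circuit_op w (xor_circuit gs)"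
    by (simp add: circuit_op_def xor_circuit_def)
  also have "layer_op w [xor_gate g] = perm_mat (2 ^ w) (xor_step g)"
    using snoc.prems by (simp add: layer_op_def gate_op_xor_gate right_mult_one_mat[OF perm_mat_carrier])
  also have "\<dots> * circuit_op w (xor_circuit gs) = perm_mat (2 ^ w) (\<lambda>x. xor_step g (run gs x))"
    using snoc by (simp add: perm_mat_mult run_less)
  finally show ?case
    by (simp add: comp_def)
qed


section \<open>Comparison with a classical constant\<close>

text \<open>Qubit \<open>s + r\<close> receives the comparison of the \<open>r\<close> lowest bits of the input with those of \<open>t\<close>.\<close>

definition comparator :: "nat \<Rightarrow> nat \<Rightarrow> nat \<Rightarrow> xor_spec list" where
  "comparator t s n =
    map (\<lambda>r. (\<lambda>u v. if u = bit t r then v else bit t r, r, s + r, Suc (s + r))) [0..<n]"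

text \<open>The most significant bit decides if it differs, and \<open>x\<close> is then smaller
  exactly if \<open>t\<close> has the 1; otherwise the lower bits decide. This is the Boolean
  function of the gates in \<open>comparator\<close>.\<close>

lemma mod_exp_Suc_less_iff:
  "x mod 2 ^ Suc r < t mod 2 ^ Suc r \<longleftrightarrow>
    (if bit x r = bit t r then x mod 2 ^ r < t mod 2 ^ r else bit t r)" for x t :: nat
proof -
  have *: "y mod 2 ^ Suc r = of_bool (bit y r) * 2 ^ r + y mod 2 ^ r" for y :: nat
    using take_bit_Suc_from_most[of r y] by (simp add: take_bit_eq_mod mult.commute)
  have lt: "x mod 2 ^ r < 2 ^ r" "t mod 2 ^ r < 2 ^ r" by simp_all
  have "\<not> 2 ^ r + x mod 2 ^ r < t mod 2 ^ r" "x mod 2 ^ r < 2 ^ r + t mod 2 ^ r"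
    using lt by linarith+
  then show ?thesis
    unfolding * by auto
qed

text \<open>Every ancilla starts at 0, so flipping it by \<open>F\<close> writes the value of
  \<open>F\<close>. Qubit \<open>s\<close> is never written: its 0 is the empty comparison, both
  residues modulo 1 being 0. By \<open>n \<le> s\<close> the input bits are preserved.\<close>

lemma bit_run_comparator:
  assumes "n \<le> s" "\<forall>j\<in>{s..s + n}. \<not> bit x j"
  shows "bit (run (comparator t s n) x) j \<longleftrightarrow>
    (if j \<in> {s..s + n} then x mod 2 ^ (j - s) < t mod 2 ^ (j - s) else bit x j)"
  using assms
proof (induction n arbitrary: j)
  case 0
  then show ?case by (simp add: comparator_def)
next
  case (Suc n)
  define y where "y = run (comparator t s n) x"
  have y: "bit y k \<longleftrightarrow>
      (if k \<in> {s..s + n} then x mod 2 ^ (k - s) < t mod 2 ^ (k - s) else bit x k)" for k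
    unfolding y_def using Suc.prems by (intro Suc.IH) auto
  have "run (comparator t s (Suc n)) x =
      xor_step (\<lambda>u v. if u = bit t n then v else bit t n, n, s + n, Suc (s + n)) y"
    by (simp add: comparator_def y_def)
  \<comment> \<open>The two controls hold the current input bit and the previous comparison, and the
    target is still 0.\<close>
  moreover have "bit y n = bit x n" "bit y (s + n) = (x mod 2 ^ n < t mod 2 ^ n)"
      "\<not> bit y (Suc (s + n))"
    using Suc.prems by (auto simp: y)
  ultimately have *: "bit (run (comparator t s (Suc n)) x) j \<longleftrightarrow>
      (if j = Suc (s + n) then x mod 2 ^ Suc n < t mod 2 ^ Suc n else bit y j)"
    by (simp only: bit_xor_step mod_exp_Suc_less_iff) auto
  show ?case
    unfolding * y by (auto simp: Suc_diff_le simp del: power_Suc)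
qed

lemma valid_spec_comparator:
  "n \<le> s \<Longrightarrow> s + n < w \<Longrightarrow> g \<in> set (comparator t s n) \<Longrightarrow> valid_spec w g"
  by (auto simp: comparator_def)

lemma avoids_comparator:
  "n \<le> k \<Longrightarrow> k < s \<Longrightarrow> g \<in> set (comparator t s n) \<Longrightarrow> avoids k g"
  by (auto simp: comparator_def)


section \<open>Tensor products with basis states, and amplitudes\<close>

lemma tensor_ket_0: "v \<in> carrier_vec (2 ^ n) \<Longrightarrow>
    v \<otimes>\<^sub>v ket k 0 = vec (2 ^ (n + k)) (\<lambda>x. if x < 2 ^ n then v $ x else 0)"
  by (rule eq_vecI)
    (auto simp: tensor_vec_def unit_vec_def power_add less_mult_imp_div_less mult.commute
      div_eq_0_iff)

lemma tensor_ket_ket: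
  assumes "i < 2 ^ n" "l < 2 ^ k"
  shows "ket n i \<otimes>\<^sub>v ket k l = ket (n + k) (i + 2 ^ n * l)"
proof (rule eq_vecI)
  fix x assume "x < dim_vec (ket (n + k) (i + 2 ^ n * l))"
  then have x: "x < 2 ^ n * 2 ^ k" by (simp add: power_add)
  have "x = i + 2 ^ n * l \<longleftrightarrow> x mod 2 ^ n = i \<and> x div 2 ^ n = l"
    using assms(1) by (auto simp: div_add1_eq)
  then show "(ket n i \<otimes>\<^sub>v ket k l) $ x = ket (n + k) (i + 2 ^ n * l) $ x"
    using x assms
    by (auto simp: tensor_vec_def unit_vec_def power_add less_mult_imp_div_less mult.commute)
qed (simp add: tensor_vec_def power_add)

lemma braket_ket: "v \<in> carrier_vec (2 ^ w) \<Longrightarrow> x < 2 ^ w \<Longrightarrow> braket (ket w x) v = v $ x"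
proof -
  assume v: "v \<in> carrier_vec (2 ^ w)" and x: "x < 2 ^ w"
  have "conjugate (ket w x) = ket w x"
    by (rule eq_vecI) (auto simp: unit_vec_def)
  with v x show ?thesis
    by (simp add: braket_def)
qed


section \<open>The interval test as a palindrome of gates\<close>

definition interval_core :: "nat \<Rightarrow> nat \<Rightarrow> nat \<Rightarrow> xor_spec list" where
  "interval_core n a b = comparator a (n + 1) n @ comparator b (2 * n + 2) n"

text \<open>
  \<open>b = 2 ^ n\<close> needs a separate treatment because a comparator only sees \<open>b mod 2 ^ n\<close>.
\<close>

definition interval_flag :: "nat \<Rightarrow> nat \<Rightarrow> xor_spec" where
  "interval_flag n b = (\<lambda>u v. \<not> u \<and> (b = 2 ^ n \<or> v), 2 * n + 1, 3 * n + 2, n)"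

text \<open>Qubit layout: input in 0 to \<open>n - 1\<close>, flag at \<open>n\<close>, ancillas of
  the comparison with \<open>a\<close> in \<open>n + 1\<close> to \<open>2 * n + 1\<close>, those of
  the comparison with \<open>b\<close> in \<open>2 * n + 2\<close> to \<open>3 * n + 2\<close>. The
  last qubit of each block holds its result, which the flag gate reads.\<close>

definition interval_specs :: "nat \<Rightarrow> nat \<Rightarrow> nat \<Rightarrow> xor_spec list" where
  "interval_specs n a b = interval_core n a b @ interval_flag n b # rev (interval_core n a b)"

lemma valid_spec_interval_core: "\<forall>g\<in>set (interval_core n a b). valid_spec (3 * n + 3) g"
  by (auto simp: interval_core_def intro: valid_spec_comparator[rotated 2])

lemma valid_spec_interval_specs:
  "n \<ge> 1 \<Longrightarrow> \<forall>g\<in>set (interval_specs n a b). valid_spec (3 * n + 3) g"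
  using valid_spec_interval_core by (auto simp: interval_specs_def interval_flag_def)

text \<open>Reversing a list of involutive gates inverts it, and this list is its own reverse. The
  identity covers all labels, including those with nonzero ancillas, as
  \<open>perm_mat_mult_vec\<close> requires.\<close>

lemma run_interval_specs_involutive:
  assumes "n \<ge> 1"
  shows "run (interval_specs n a b) (run (interval_specs n a b) x) = x"
proof -
  have "rev (interval_specs n a b) = interval_specs n a b"
    by (simp add: interval_specs_def)
  then show ?thesis
    using run_rev_run[OF valid_spec_interval_specs[OF assms]] by metis
qed

lemma run_interval_specs:
  assumes "n \<ge> 1" "a < 2 ^ n" "b \<le> 2 ^ n" "i < 2 ^ n"
  shows "run (interval_specs n a b) i = (if a \<le> i \<and> i < b then i + 2 ^ n else i)"
proof -
  define C where "C = interval_core n a b"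
  have av: "\<forall>g\<in>set (rev C). avoids n g"
    by (auto simp: C_def interval_core_def intro: avoids_comparator[rotated 2])
  have inv: "run (rev C) (run C i) = i"
    unfolding C_def by (rule run_rev_run[OF valid_spec_interval_core])
  have i: "\<not> bit i j" if "j \<ge> n" for j
    using assms(4) that less_exp_iff_bit by blast
  define y where "y = run (comparator a (n + 1) n) i"
  have y: "bit y j \<longleftrightarrow>
      (if j \<in> {n + 1..n + 1 + n} then i mod 2 ^ (j - (n + 1)) < a mod 2 ^ (j - (n + 1)) else bit i j)" for j
    unfolding y_def by (rule bit_run_comparator) (auto simp: i)
  have z: "bit (run C i) j \<longleftrightarrow>
      (if j \<in> {2 * n + 2..2 * n + 2 + n}
       then y mod 2 ^ (j - (2 * n + 2)) < b mod 2 ^ (j - (2 * n + 2)) else bit y j)" for j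
    unfolding C_def interval_core_def fold_append comp_def y_def[symmetric]
    by (rule bit_run_comparator) (auto simp: i y)
  \<comment> \<open>The first comparator writes only to its ancillas, so the second still sees the
    low bits of \<open>i\<close>.\<close>
  have "take_bit n y = take_bit n i"
    by (rule bit_eqI) (auto simp: bit_take_bit_iff y)
  then have "y mod 2 ^ n = i"
    using assms(4) by (simp add: take_bit_eq_mod)
  then have "bit (run C i) (3 * n + 2) \<longleftrightarrow> i < b mod 2 ^ n"
    by (simp add: z)
  moreover have "bit (run C i) (2 * n + 1) \<longleftrightarrow> i < a"
    using assms by (simp add: z y)
  \<comment> \<open>In the excluded case \<open>b = 2 ^ n\<close> the upper bound holds for every
    input, and the flag gate disregards the second comparison.\<close>
  moreover have "b mod 2 ^ n = b" if "b \<noteq> 2 ^ n"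
    using assms(3) that by simp
  ultimately have "xor_step (interval_flag n b) (run C i) =
      (if a \<le> i \<and> i < b then flip_bit n (run C i) else run C i)"
    using assms(4) by (auto simp: interval_flag_def xor_step.simps not_less)
  then have "run (interval_specs n a b) i =
      (if a \<le> i \<and> i < b then run (rev C) (flip_bit n (run C i)) else i)"
    by (simp add: interval_specs_def C_def[symmetric] inv)
  also have "run (rev C) (flip_bit n (run C i)) = flip_bit n i"
    by (simp add: run_flip_bit[OF av] inv)
  \<comment> \<open>Bit \<open>n\<close> of the input label is 0, so the flip sets it.\<close>
  also have "flip_bit n i = i + 2 ^ n"
    using i by (simp add: flip_bit_eq_if set_bit_eq)
  finally show ?thesis .
qed

theorem mainTheorem2:
  shows "\<exists>anc dep :: nat \<Rightarrow> nat.
    (\<lambda>n. real (anc n)) \<in> O(\<lambda>n. real n) \<and> (\<lambda>n. real (dep n)) \<in> O(\<lambda>n. real n) \<and>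
    (\<forall>n a M :: nat. n \<ge> 1 \<and> M \<ge> 1 \<and> a + M \<le> 2 ^ n \<longrightarrow>
      (\<exists>(m :: nat) (c :: circuit).
        m \<le> anc n \<and> valid_circuit (n + 1 + m) c \<and> depth c \<le> dep n \<and>
        (\<forall>i < 2 ^ n.
          circuit_op (n + 1 + m) c *\<^sub>v (ket n i \<otimes>\<^sub>v ket 1 0 \<otimes>\<^sub>v ket m 0) =
            (if a \<le> i \<and> i < a + M then ket n i \<otimes>\<^sub>v ket 1 1 \<otimes>\<^sub>v ket m 0
             else ket n i \<otimes>\<^sub>v ket 1 0 \<otimes>\<^sub>v ket m 0)) \<and>
        (\<forall>\<psi>_test \<psi>_sequency.
          \<psi>_test \<in> carrier_vec (2 ^ n) \<and> normalized \<psi>_test \<and>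
          \<psi>_sequency = seq_walsh_hadamard n *\<^sub>v \<psi>_test \<longrightarrow>
          prob_one (n + 1 + m) n
            (circuit_op (n + 1 + m) c *\<^sub>v (\<psi>_sequency \<otimes>\<^sub>v ket 1 0 \<otimes>\<^sub>v ket m 0)) =
          (\<Sum>j = a..<a + M. (cmod (braket (ket n j) \<psi>_sequency))\<^sup>2))))"
proof (rule exI[of _ "\<lambda>n. 4 * n"], rule exI[of _ "\<lambda>n. 5 * n"], intro conjI allI impI)
  show "(\<lambda>n. real (4 * n)) \<in> O(\<lambda>n. real n)" "(\<lambda>n. real (5 * n)) \<in> O(\<lambda>n. real n)"
    by simp_all
next
  fix n a M :: nat
  assume "n \<ge> 1 \<and> M \<ge> 1 \<and> a + M \<le> 2 ^ n"
  then have n: "n \<ge> 1" and a: "a < 2 ^ n" and b: "a + M \<le> 2 ^ n" by auto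
  define gs where "gs = interval_specs n a (a + M)"
  define c where "c = xor_circuit gs"
  \<comment> \<open>Each of the two comparators occupies \<open>n + 1\<close> ancillas; the total is
    at most \<open>4 * n\<close> because \<open>n \<ge> 1\<close>.\<close>
  define m where "m = 2 * n + 2"
  define w where "w = n + 1 + m"
  have w: "w = 3 * n + 3" by (simp add: w_def m_def)
  have valid: "\<forall>g\<in>set gs. valid_spec w g"
    unfolding gs_def w using n by (rule valid_spec_interval_specs)
  have less: "run gs x < 2 ^ w" if "x < 2 ^ w" for x
    using run_less[OF valid that] .
  have invol: "run gs (run gs x) = x" for x
    unfolding gs_def using n by (rule run_interval_specs_involutive)
  have op: "circuit_op w c = perm_mat (2 ^ w) (run gs)"
    unfolding c_def using valid by (rule circuit_op_xor_circuit)
  have run: "run gs i = (if a \<le> i \<and> i < a + M then i + 2 ^ n else i)" if "i < 2 ^ n" for i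
    unfolding gs_def using n a b that by (rule run_interval_specs)
  have nw: "x < 2 ^ w" if "x < 2 ^ n" for x :: nat
    using that by (simp add: less_exp_iff_bit w)
  \<comment> \<open>Two comparators of \<open>n\<close> gates, run forwards and backwards around the
    flag gate, make \<open>4 * n + 1\<close> gates.\<close>
  have depth: "depth c \<le> 5 * n"
    using n by (simp add: depth_def c_def xor_circuit_def gs_def interval_specs_def
        interval_core_def comparator_def)
  have flagged: "ket n i \<otimes>\<^sub>v ket 1 l \<otimes>\<^sub>v ket m 0 = ket w (i + 2 ^ n * l)"
    if "i < 2 ^ n" "l < 2" for i l
  proof -
    have "i + 2 ^ n * l < 2 ^ (n + 1)"
      using that by (cases l) auto
    with that show ?thesis
      using tensor_ket_ket[of i n l 1] tensor_ket_ket[of "i + 2 ^ n * l" "n + 1" 0 m]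
      by (simp add: w_def)
  qed
  have basis: "circuit_op w c *\<^sub>v (ket n i \<otimes>\<^sub>v ket 1 0 \<otimes>\<^sub>v ket m 0) =
      (if a \<le> i \<and> i < a + M then ket n i \<otimes>\<^sub>v ket 1 1 \<otimes>\<^sub>v ket m 0
       else ket n i \<otimes>\<^sub>v ket 1 0 \<otimes>\<^sub>v ket m 0)" if "i < 2 ^ n" for i
    using that flagged[OF that, of 0] flagged[OF that, of 1]
    by (simp add: op perm_mat_mult_unit_vec[OF less invol nw] run)
  have prob: "prob_one w n (circuit_op w c *\<^sub>v (\<psi> \<otimes>\<^sub>v ket 1 0 \<otimes>\<^sub>v ket m 0)) =
      (\<Sum>j = a..<a + M. (cmod (braket (ket n j) \<psi>))\<^sup>2)" if psi: "\<psi> \<in> carrier_vec (2 ^ n)" for \<psi>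
  proof -
    \<comment> \<open>The input with flag and ancillas at 0: those are the high-order qubits, so the
      amplitudes are padded with zeros.\<close>
    define \<phi> where "\<phi> = vec (2 ^ w) (\<lambda>x. if x < 2 ^ n then \<psi> $ x else 0)"
    have \<phi>: "\<phi> \<in> carrier_vec (2 ^ w)" by (simp add: \<phi>_def)
    have 1: "\<psi> \<otimes>\<^sub>v ket 1 0 = vec (2 ^ (n + 1)) (\<lambda>x. if x < 2 ^ n then \<psi> $ x else 0)"
      by (rule tensor_ket_0[OF psi])
    have "\<psi> \<otimes>\<^sub>v ket 1 0 \<otimes>\<^sub>v ket m 0 = \<phi>"
      unfolding 1 by (subst tensor_ket_0[where n = "n + 1"]) (auto simp: \<phi>_def w_def intro!: eq_vecI)
    then have "prob_one w n (circuit_op w c *\<^sub>v (\<psi> \<otimes>\<^sub>v ket 1 0 \<otimes>\<^sub>v ket m 0)) =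
        (\<Sum>x | x < 2 ^ w \<and> bit x n. (cmod (\<phi> $ run gs x))\<^sup>2)"
      by (simp add: prob_one_def op perm_mat_mult_vec[OF less invol \<phi>] braket_ket)
    also have "\<dots> = (\<Sum>y | y < 2 ^ w \<and> bit (run gs y) n. (cmod (\<phi> $ y))\<^sup>2)"
      by (rule sum.reindex_bij_witness[of _ "run gs" "run gs"]) (auto simp: invol less)
    also have "\<dots> = (\<Sum>y = a..<a + M. (cmod (\<phi> $ y))\<^sup>2)"
    proof (rule sum.mono_neutral_right)
      \<comment> \<open>Only labels below \<open>2 ^ n\<close> need this description: beyond them
        \<open>\<phi>\<close> vanishes, so whether their images carry the flag does not affect the
        sum.\<close>
      have "bit (run gs y) n \<longleftrightarrow> a \<le> y \<and> y < a + M" if "y < 2 ^ n" for y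
      proof -
        have "\<not> bit y n" using that less_exp_iff_bit by blast
        moreover from this have "y + 2 ^ n = set_bit n y"
          by (simp add: set_bit_eq)
        ultimately show ?thesis using run[OF that] by (simp add: bit_set_bit_iff)
      qed
      then show "{a..<a + M} \<subseteq> {y. y < 2 ^ w \<and> bit (run gs y) n}"
        "\<forall>y\<in>{y. y < 2 ^ w \<and> bit (run gs y) n} - {a..<a + M}. (cmod (\<phi> $ y))\<^sup>2 = 0"
        using b by (auto simp: \<phi>_def nw)
    qed simp
    also have "\<dots> = (\<Sum>j = a..<a + M. (cmod (braket (ket n j) \<psi>))\<^sup>2)"
      using b by (intro sum.cong) (auto simp: \<phi>_def nw braket_ket[OF psi])
    finally show ?thesis .
  qed
  show "\<exists>m c. m \<le> 4 * n \<and> valid_circuit (n + 1 + m) c \<and> depth c \<le> 5 * n \<and>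
        (\<forall>i < 2 ^ n.
          circuit_op (n + 1 + m) c *\<^sub>v (ket n i \<otimes>\<^sub>v ket 1 0 \<otimes>\<^sub>v ket m 0) =
            (if a \<le> i \<and> i < a + M then ket n i \<otimes>\<^sub>v ket 1 1 \<otimes>\<^sub>v ket m 0
             else ket n i \<otimes>\<^sub>v ket 1 0 \<otimes>\<^sub>v ket m 0)) \<and>
        (\<forall>\<psi>_test \<psi>_sequency.
          \<psi>_test \<in> carrier_vec (2 ^ n) \<and> normalized \<psi>_test \<and>
          \<psi>_sequency = seq_walsh_hadamard n *\<^sub>v \<psi>_test \<longrightarrow>
          prob_one (n + 1 + m) n
            (circuit_op (n + 1 + m) c *\<^sub>v (\<psi>_sequency \<otimes>\<^sub>v ket 1 0 \<otimes>\<^sub>v ket m 0)) =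
          (\<Sum>j = a..<a + M. (cmod (braket (ket n j) \<psi>_sequency))\<^sup>2))"
  proof (rule exI[of _ m], rule exI[of _ c], fold w_def, intro conjI allI impI)
    show "m \<le> 4 * n" using n by (simp add: m_def)
    show "valid_circuit w c" unfolding c_def using valid by (rule valid_xor_circuit)
    show "depth c \<le> 5 * n" by (rule depth)
  next
    fix \<psi>_test \<psi>_sequency
    assume "\<psi>_test \<in> carrier_vec (2 ^ n) \<and> normalized \<psi>_test \<and>
      \<psi>_sequency = seq_walsh_hadamard n *\<^sub>v \<psi>_test"
    then have "\<psi>_sequency \<in> carrier_vec (2 ^ n)"
      by (auto simp: seq_walsh_hadamard_def intro!: carrier_vecI)
    then show "prob_one w n (circuit_op w c *\<^sub>v (\<psi>_sequency \<otimes>\<^sub>v ket 1 0 \<otimes>\<^sub>v ket m 0)) =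
      (\<Sum>j = a..<a + M. (cmod (braket (ket n j) \<psi>_sequency))\<^sup>2)"
      by (rule prob)
  qed (rule basis)
qed

end
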